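(* Let $n$ be a positive integer, let $1\leq m_1<m_2<\cdots<m_r\leq n$ be integers, let $q_1,\ldots,q_r$ be positive integers, and let $M$ be the set consisting of $q_1$ different types of $m_1$, $q_2$ different types of $m_2$, ..., $q_r$ different types of $m_r$. Let $c(n,M')$ denote the number of compositions of $n$ each of whose parts belongs to $M$. Let $P_n=(p_{i,j})$ be the $n\times n$ matrix defined by $$p_{i,j}=\begin{cases}-1 & \text{if } i=j+1,\\ q_k & \text{if } j-i=m_k-1 \text{ for some } k\in\{1,\ldots,r\},\\ 0 & \text{otherwise.}\end{cases}$$ Then $$c(n,M')=\det P_n.$$
   Context: A composition of $n$ is an ordered sequence of positive parts whose sum is $n$; here each part equal to $m_i$ comes in one of $q_i$ types, and compositions that differ in the types of their parts are counted as different. *)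

theory Defs
  imports "Jordan_Normal_Form.Determinant"
begin

text \<open>A part is a pair of its value and its type, so two parts of the same value but of different
  types are different.\<close>

definition typed_parts :: "nat \<Rightarrow> (nat \<Rightarrow> nat) \<Rightarrow> (nat \<Rightarrow> nat) \<Rightarrow> (nat \<times> nat) set" where
  "typed_parts r m q = {(m k, t) | k t. k \<in> {1..r} \<and> t \<in> {1..q k}}"

definition compositions :: "nat \<Rightarrow> (nat \<times> nat) list set" where
  "compositions n = {ps. (\<forall>p \<in> set ps. fst p > 0) \<and> sum_list (map fst ps) = n}"

definition num_compositions :: "nat \<Rightarrow> (nat \<times> nat) set \<Rightarrow> nat" where
  "num_compositions n M = card {ps \<in> compositions n. set ps \<subseteq> M}"

text \<open>Matrix indices start at 0 here; the entries depend only on \<open>j - i\<close>, which the shift of both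
  indices leaves unchanged. The difference is taken in the integers because subtraction of natural
  numbers truncates. The description \<open>THE\<close> is proper when \<open>m\<close> is injective on \<open>{1..r}\<close>.\<close>

definition P_mat :: "nat \<Rightarrow> nat \<Rightarrow> (nat \<Rightarrow> nat) \<Rightarrow> (nat \<Rightarrow> nat) \<Rightarrow> int mat" where
  "P_mat n r m q = mat n n (\<lambda>(i, j).
     if i = j + 1 then - 1
     else if \<exists>k \<in> {1..r}. int j - int i = int (m k) - 1
       then int (q (THE k. k \<in> {1..r} \<and> int j - int i = int (m k) - 1))
     else 0)"

end

theory Submission
  imports Defs
begin

text \<open>Splitting off the first part gives \<open>c\<^sub>n = (\<Sum>d=1..n. w\<^sub>d c\<^bsub>n-d\<^esub>)\<close>, where \<open>w\<^sub>d\<close> is the number of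
  types of the part \<open>d\<close>. The matrix \<open>P\<^sub>n\<close> is the Toeplitz--Hessenberg matrix of the weights \<open>w\<close>, and
  the recurrence says that it maps the vector \<open>(c\<^bsub>n-1\<^esub>, \<dots>, c\<^sub>1, c\<^sub>0)\<close> to \<open>(c\<^sub>n, 0, \<dots>, 0)\<close>. As \<open>c\<^sub>0 = 1\<close>,
  the last column may be replaced by this image without changing the determinant; expanding along
  it leaves \<open>c\<^sub>n\<close> times the determinant of a triangular matrix with diagonal entries \<open>-1\<close>.\<close>

definition hessenberg_toeplitz :: "nat \<Rightarrow> (nat \<Rightarrow> 'a) \<Rightarrow> 'a :: comm_ring_1 mat" where
  "hessenberg_toeplitz n w = mat n n (\<lambda>(i, j).
     if i = j + 1 then - 1 else if i \<le> j then w (j - i + 1) else 0)"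

text \<open>Left of the diagonal only the subdiagonal entry of row \<open>i\<close> is nonzero, and
  it contributes \<open>- c (n - i)\<close>. From the diagonal on, the row sums to the right-hand
  side of the recurrence for \<open>c (n - i)\<close>. The two cancel except in row 0, which has no
  subdiagonal entry.\<close>

lemma hessenberg_toeplitz_mult_vec:
  fixes w c :: "nat \<Rightarrow> 'a :: comm_ring_1"
  assumes rec: "\<And>k. k \<ge> 1 \<Longrightarrow> c k = (\<Sum>d=1..k. w d * c (k - d))" and "i < n"
  shows "(\<Sum>j<n. hessenberg_toeplitz n w $$ (i, j) * c (n - 1 - j)) = (if i = 0 then c n else 0)"
proof -
  have "(\<Sum>j<n. hessenberg_toeplitz n w $$ (i, j) * c (n - 1 - j))
    = (\<Sum>j<i. hessenberg_toeplitz n w $$ (i, j) * c (n - 1 - j))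
    + (\<Sum>j=i..<n. hessenberg_toeplitz n w $$ (i, j) * c (n - 1 - j))"
    using \<open>i < n\<close> unfolding lessThan_atLeast0 by (simp add: sum.atLeastLessThan_concat)
  also have "(\<Sum>j<i. hessenberg_toeplitz n w $$ (i, j) * c (n - 1 - j))
    = (if i = 0 then 0 else - c (n - i))"
  proof (cases i)
    case (Suc i')
    have "(\<Sum>j<i. hessenberg_toeplitz n w $$ (i, j) * c (n - 1 - j))
      = (\<Sum>j<i. if j = i' then - c (n - i) else 0)"
      using \<open>i < n\<close> Suc by (intro sum.cong) (auto simp: hessenberg_toeplitz_def)
    also have "\<dots> = - c (n - i)"
      using Suc by simp
    finally show ?thesis
      using Suc by simp
  qed simp
  also have "(\<Sum>j=i..<n. hessenberg_toeplitz n w $$ (i, j) * c (n - 1 - j))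
    = (\<Sum>d=1..n - i. w d * c (n - i - d))"
    \<comment> \<open>With \<open>d = j - i + 1\<close>, the index \<open>n - 1 - j\<close> becomes
      \<open>n - i - d\<close>.\<close>
    by (rule sum.reindex_bij_witness[where i = "\<lambda>d. d + i - 1" and j = "\<lambda>j. j - i + 1"])
      (use \<open>i < n\<close> in \<open>auto simp: hessenberg_toeplitz_def\<close>)
  also have "\<dots> = c (n - i)"
    using \<open>i < n\<close> by (intro rec[symmetric]) simp
  finally show ?thesis
    by simp
qed

lemma det_hessenberg_toeplitz:
  fixes w c :: "nat \<Rightarrow> 'a :: comm_ring_1"
  assumes c0: "c 0 = 1" and rec: "\<And>k. k \<ge> 1 \<Longrightarrow> c k = (\<Sum>d=1..k. w d * c (k - d))"
  shows "det (hessenberg_toeplitz n w) = c n"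
proof (cases n)
  case 0
  then show ?thesis
    by (simp add: c0 hessenberg_toeplitz_def det_dim_zero)
next
  case (Suc l)
  define H where "H = hessenberg_toeplitz n w"
  \<comment> \<open>The identity with its last column replaced by the vector of values of
    \<open>c\<close>. Its corner entry is \<open>c 0 = 1\<close>, so it is unit upper triangular,
    and multiplying by it changes only the last column of \<open>H\<close>.\<close>
  define B where "B = mat n n (\<lambda>(i, j). if j = l then c (l - i) else if i = j then 1 else (0 :: 'a))"
  have H: "H \<in> carrier_mat n n" and B: "B \<in> carrier_mat n n"
    by (simp_all add: H_def B_def hessenberg_toeplitz_def)
  have HB: "H * B \<in> carrier_mat n n"
    using H B by simp
  then have dim_HB: "dim_row (H * B) = n" "dim_col (H * B) = n"
    by auto
  have entry: "(H * B) $$ (i, j) = (\<Sum>k<n. H $$ (i, k) * B $$ (k, j))" if "i < n" "j < n" for i j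
    using that H B by (auto simp: scalar_prod_def lessThan_atLeast0 intro!: sum.cong)
  have last: "(H * B) $$ (i, l) = (if i = 0 then c n else 0)" if "i < n" for i
  proof -
    have "(H * B) $$ (i, l) = (\<Sum>k<n. H $$ (i, k) * c (n - 1 - k))"
      using that Suc by (subst entry) (simp_all add: B_def)
    then show ?thesis
      using hessenberg_toeplitz_mult_vec[OF rec that] by (simp add: H_def)
  qed
  have other: "(H * B) $$ (i, j) = H $$ (i, j)" if "i < n" "j < l" for i j
  proof -
    have "(H * B) $$ (i, j) = (\<Sum>k<n. if k = j then H $$ (i, k) else 0)"
      using that Suc unfolding entry[OF that(1) less_SucI[OF that(2), folded Suc]]
      by (intro sum.cong) (auto simp: B_def)
    then show ?thesis
      using that Suc by simp
  qed
  have "det B = prod_list (diag_mat B)"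
    by (rule det_upper_triangular[OF _ B]) (auto simp: B_def Suc upper_triangular_def)
  also have "\<dots> = (\<Prod>i = 0..<n. B $$ (i, i))"
    using B by (simp add: prod_list_diag_prod)
  also have "\<dots> = 1"
    by (intro prod.neutral) (auto simp: B_def c0)
  finally have det_B: "det B = 1" .
  \<comment> \<open>Deleting row 0 moves the subdiagonal of \<open>H\<close> onto the diagonal of
    \<open>D\<close>; everything below it vanishes.\<close>
  define D where "D = mat_delete (H * B) 0 l"
  have D: "D \<in> carrier_mat l l"
    using mat_delete_carrier[OF HB, of 0 l] by (simp add: D_def Suc)
  have D_entry: "D $$ (i, j) = H $$ (Suc i, j)" if "i < l" "j < l" for i j
  proof -
    have "D $$ (i, j) = (H * B) $$ (Suc i, j)"
      unfolding D_def mat_delete_def dim_HB using that by (simp add: Suc del: index_mult_mat)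
    with that show ?thesis
      by (simp only: other Suc Suc_less_eq)
  qed
  have "det D = prod_list (diag_mat D)"
    by (rule det_upper_triangular[OF _ D])
      (use D Suc in \<open>auto simp: D_entry H_def hessenberg_toeplitz_def upper_triangular_def\<close>)
  also have "\<dots> = (\<Prod>i = 0..<l. D $$ (i, i))"
    using D by (simp add: prod_list_diag_prod)
  also have "\<dots> = (\<Prod>i = 0..<l. - 1)"
    by (intro prod.cong) (use Suc in \<open>auto simp: D_entry H_def hessenberg_toeplitz_def\<close>)
  finally have det_D: "det D = (- 1) ^ l"
    by simp
  have "det H = det (H * B)"
    by (simp add: det_mult[OF H B] det_B)
  also have "\<dots> = (\<Sum>i<n. (H * B) $$ (i, l) * cofactor (H * B) i l)"
    by (rule laplace_expansion_column[OF HB]) (simp add: Suc)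
  also have "\<dots> = (\<Sum>i<n. if i = 0 then c n * cofactor (H * B) i l else 0)"
    by (intro sum.cong) (auto simp: last)
  also have "\<dots> = c n * cofactor (H * B) 0 l"
    by (simp add: Suc)
  also have "\<dots> = c n"
    \<comment> \<open>The cofactor sign \<open>(- 1) ^ (0 + l)\<close> cancels
      \<open>det D = (- 1) ^ l\<close>.\<close>
    using det_D by (simp add: cofactor_def D_def flip: power_mult_distrib)
  finally show ?thesis
    by (simp add: H_def)
qed

lemma restricted_compositions_0: "{ps \<in> compositions 0. set ps \<subseteq> M} = {[]}"
proof -
  have "ps = []" if "\<forall>p \<in> set ps. fst p > 0" "sum_list (map fst ps) = 0" for ps :: "(nat \<times> nat) list"
    using that by (cases ps) auto
  then show ?thesis
    by (auto simp: compositions_def)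
qed

lemma restricted_compositions_rec:
  assumes "n \<ge> 1"
  shows "{ps \<in> compositions n. set ps \<subseteq> M} =
    (\<Union>d \<in> {1..n}. (\<lambda>(t, ps). (d, t) # ps) ` (M `` {d} \<times> {ps \<in> compositions (n - d). set ps \<subseteq> M}))"
    (is "?L = ?R")
proof (intro equalityI subsetI)
  fix ps assume ps: "ps \<in> ?L"
  then obtain d t qs where "ps = (d, t) # qs"
    using assms by (cases ps) (auto simp: compositions_def)
  with ps have "d \<in> {1..n}" "(t, qs) \<in> M `` {d} \<times> {ps \<in> compositions (n - d). set ps \<subseteq> M}"
    by (auto simp: compositions_def)
  then show "ps \<in> ?R"
    unfolding \<open>ps = (d, t) # qs\<close> by (intro UN_I) (auto intro: rev_image_eqI)
qed (auto simp: compositions_def)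

lemma finite_restricted_compositions:
  assumes "\<And>d. finite (M `` {d})"
  shows "finite {ps \<in> compositions n. set ps \<subseteq> M}"
proof (induction n rule: less_induct)
  case (less n)
  show ?case
  proof (cases "n = 0")
    case False
    with less have "finite {ps \<in> compositions (n - d). set ps \<subseteq> M}" if "d \<in> {1..n}" for d
      using that by simp
    with False assms show ?thesis
      by (subst restricted_compositions_rec) (auto intro!: finite_imageI finite_cartesian_product)
  qed (simp only: restricted_compositions_0 finite.intros)
qed

lemma num_compositions_0: "num_compositions 0 M = 1"
  by (simp only: num_compositions_def restricted_compositions_0) simp

text \<open>The sets in the union are disjoint, since a list determines the value \<open>d\<close>
  of its head, and prepending a part is injective.\<close>

lemma num_compositions_rec:
  assumes "\<And>d. finite (M `` {d})" and "n \<ge> 1"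
  shows "num_compositions n M = (\<Sum>d=1..n. card (M `` {d}) * num_compositions (n - d) M)"
proof -
  have "inj_on (\<lambda>(t, ps). (d, t) # ps) A" for d :: nat and A :: "(nat \<times> (nat \<times> nat) list) set"
    by (auto simp: inj_on_def)
  then show ?thesis
    unfolding num_compositions_def restricted_compositions_rec[OF assms(2)]
    by (subst card_UN_disjoint)
      (auto simp: card_image card_cartesian_product
        intro!: finite_imageI finite_cartesian_product assms(1) finite_restricted_compositions)
qed

lemma typed_parts_Image:
  assumes "inj_on m {1..r}" and "k \<in> {1..r}"
  shows "typed_parts r m q `` {m k} = {1..q k}"
  using assms by (auto simp: typed_parts_def dest: inj_onD)

lemma typed_parts_Image_empty:
  assumes "d \<notin> m ` {1..r}"
  shows "typed_parts r m q `` {d} = {}"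
  using assms by (auto simp: typed_parts_def)

text \<open>Injectivity of \<open>m\<close> makes the \<open>THE\<close> in \<open>P_mat\<close>
  pick the only matching \<open>k\<close>, and gives the value \<open>m k\<close> exactly
  \<open>q k\<close> types. A value outside the range of \<open>m\<close> has no types, hence weight
  0.\<close>

lemma P_mat_eq_hessenberg_toeplitz:
  assumes inj: "inj_on m {1..r}" and pos: "\<And>k. k \<in> {1..r} \<Longrightarrow> m k \<ge> 1"
  shows "P_mat n r m q = hessenberg_toeplitz n (\<lambda>d. int (card (typed_parts r m q `` {d})))"
    (is "_ = ?H")
proof (rule eq_matI)
  fix i j assume "i < dim_row ?H" "j < dim_col ?H"
  then have ij: "i < n" "j < n"
    by (simp_all add: hessenberg_toeplitz_def)
  \<comment> \<open>Since \<open>m k \<ge> 1\<close>, the integer difference is nonnegative, so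
    truncated subtraction agrees with it.\<close>
  have diff: "int j - int i = int (m k) - 1 \<longleftrightarrow> i \<le> j \<and> m k = j - i + 1" if "k \<in> {1..r}" for k
    using pos[OF that] by auto
  show "P_mat n r m q $$ (i, j) = ?H $$ (i, j)"
  proof (cases "\<exists>k \<in> {1..r}. int j - int i = int (m k) - 1")
    case True
    then obtain k where k: "k \<in> {1..r}" "int j - int i = int (m k) - 1"
      by blast
    then have le: "i \<le> j" and mk: "j - i + 1 = m k"
      using diff by auto
    have "(THE k. k \<in> {1..r} \<and> int j - int i = int (m k) - 1) = k"
      using k inj by (intro the_equality) (auto dest: inj_onD)
    with True le ij have "P_mat n r m q $$ (i, j) = int (q k)"
      by (simp add: P_mat_def)
    moreover have "?H $$ (i, j) = int (q k)"
      using le ij typed_parts_Image[OF inj k(1)] by (simp add: hessenberg_toeplitz_def mk[simplified])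
    ultimately show ?thesis
      by simp
  next
    case False
    then have "j - i + 1 \<notin> m ` {1..r}" if "i \<le> j"
      using that diff by force
    with False ij show ?thesis
      by (auto simp: P_mat_def hessenberg_toeplitz_def typed_parts_Image_empty)
  qed
qed (simp_all add: P_mat_def hessenberg_toeplitz_def)

theorem theorem4:
  fixes n r :: nat and m q :: "nat \<Rightarrow> nat"
  assumes "n \<ge> 1" and "r \<ge> 1"
    and "strict_mono_on {1..r} m" and "1 \<le> m 1" and "m r \<le> n"
    and "\<And>k. k \<in> {1..r} \<Longrightarrow> q k \<ge> 1"
  shows "int (num_compositions n (typed_parts r m q)) = det (P_mat n r m q)"
proof -
  let ?M = "typed_parts r m q"
  have inj: "inj_on m {1..r}"
    using assms(3) by (rule strict_mono_on_imp_inj_on)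
  have "m 1 \<le> m k" if "k \<in> {1..r}" for k
    using that strict_mono_on_leD[OF assms(3), of 1 k] by auto
  then have pos: "m k \<ge> 1" if "k \<in> {1..r}" for k
    using that assms(4) le_trans by blast
  have fin: "finite (?M `` {d})" for d
    by (cases "d \<in> m ` {1..r}") (auto simp: typed_parts_Image[OF inj] typed_parts_Image_empty)
  have "int (num_compositions k ?M)
    = (\<Sum>d=1..k. int (card (?M `` {d})) * int (num_compositions (k - d) ?M))" if "k \<ge> 1" for k
    unfolding num_compositions_rec[OF fin that] by simp
  then have "det (hessenberg_toeplitz n (\<lambda>d. int (card (?M `` {d})))) = int (num_compositions n ?M)"
    by (intro det_hessenberg_toeplitz[where c = "\<lambda>k. int (num_compositions k ?M)"])
      (simp_all add: num_compositions_0)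
  then show ?thesis
    using P_mat_eq_hessenberg_toeplitz[OF inj pos] by simp
qed

end
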